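(* Let $\mathcal{S}=\langle S,s_0,\tau,l\rangle$ be a $\Gamma$-labeled $\Upsilon$-transition system, let $\forall\pi_1\ldots\forall\pi_n.\ \exists\pi'_1\ldots\exists\pi'_m.\ \varphi$ be a HyperLTL formula with $\varphi$ quantifier-free, and let $\mathcal{S}_\exists=\langle X,x_0,\mu,l_\exists\rangle$ with $X$ finite, $x_0\in X$, $\mu\colon X\times\Upsilon^n\to X$, $l_\exists\colon X\to\Upsilon^m$. Let $\mathcal{A}_\varphi=\langle Q,q_0,\delta,F\rangle$ be a universal co-Büchi automaton for $\varphi$. If the run graph $\mathcal{S}^n\times(\mathcal{S}^m\,\|\,\mathcal{S}_\exists)\times\mathcal{A}_\varphi$ is accepting, then $\mathcal{S}\models\forall\pi_1\ldots\forall\pi_n.\ \exists\pi'_1\ldots\exists\pi'_m.\ \varphi$.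
   Context: $I,O$ disjoint finite proposition sets, $\Upsilon=2^I$, $\Gamma=2^O$, $\mathrm{AP}=I\cup O$, $\Sigma=2^{\mathrm{AP}}$. A $\Gamma$-labeled $\Upsilon$-transition system $\langle S,s_0,\tau,l\rangle$: finite $S$, $s_0\in S$, $\tau\colon S\times\Upsilon\to S$, $l\colon S\to\Gamma$; $\tau^*(\epsilon)=s_0$, $\tau^*(x\upsilon)=\tau(\tau^*(x),\upsilon)$; the trace on $\upsilon_0\upsilon_1\ldots\in\Upsilon^\omega$ is $(\upsilon_0\cup\gamma_0)(\upsilon_1\cup\gamma_1)\ldots$ with $\gamma_i=l(\tau^*(\upsilon_0\cdots\upsilon_{i-1}))$, and $\mathit{traces}(\mathcal{S})$ is the set of all traces. For $k\ge0$, $\tau_k\colon S^k\times\Upsilon^k\to S^k$ and $l_k\colon S^k\to\Gamma^k$ apply $\tau$ and $l$ componentwise. A universal co-Büchi automaton for $\varphi$ is $\mathcal{A}_\varphi=\langle Q,q_0,\delta,F\rangle$ with finite $Q$, $q_0\in Q$, rejecting set $F\subseteq Q$ and $\delta\colon Q\times\Upsilon^{n+m}\times\Gamma^{n+m}\to 2^Q$; it accepts a word $(\vec\upsilon_0,\vec\gamma_0)(\vec\upsilon_1,\vec\gamma_1)\ldots$ iff every infinite sequence $q_0q_1\ldots$ with $q_{i+1}\in\delta(q_i,\vec\upsilon_i,\vec\gamma_i)$ visits $F$ only finitely often. "For $\varphi$" means: it accepts exactly those words for which the assignment mapping $\pi_j$ ($1\le j\le n$) to the trace $(\upsilon_0^j\cup\gamma_0^j)(\upsilon_1^j\cup\gamma_1^j)\ldots$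 and $\pi'_k$ to $(\upsilon_0^{n+k}\cup\gamma_0^{n+k})\ldots$ satisfies $\varphi$ at position $0$ (standard LTL semantics with $a_\pi$ true at $i$ iff $a\in\Pi(\pi)[i]$). The run graph $\mathcal{S}^n\times(\mathcal{S}^m\,\|\,\mathcal{S}_\exists)\times\mathcal{A}_\varphi$ is the directed graph with vertices $S^n\times S^m\times X\times Q$, initial vertex $v_{init}=((s_0,\dots,s_0),(s_0,\dots,s_0),x_0,q_0)$, and an edge from $(\vec s_n,\vec s_m,x,q)$ to $(\vec s_n',\vec s_m',x',q')$ iff there is $\vec\upsilon\in\Upsilon^n$ with $\vec s_n'=\tau_n(\vec s_n,\vec\upsilon)$, $\vec s_m'=\tau_m(\vec s_m,l_\exists(x))$, $x'=\mu(x,\vec\upsilon)$, and $q'\in\delta(q,\vec\upsilon\cdot l_\exists(x),l_n(\vec s_n)\cdot l_m(\vec s_m))$ ($\cdot$ is tuple concatenation). It is accepting iff every infinite path starting in $v_{init}$ visits only finitely often vertices whose $Q$-component lies in $F$. $\mathcal{S}\models\forall\pi_1\ldots\exists\pi'_m.\varphi$ is HyperLTL satisfaction with trace quantifiers ranging over $\mathit{traces}(\mathcal{S})$. *)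

theory Defs
  imports "HOL-Library.Omega_Words_Fun"
begin

record ('s, 'i, 'o) ts =
  ts_states :: "'s set"
  ts_init :: 's
  ts_trans :: "'s \<Rightarrow> 'i \<Rightarrow> 's"
  ts_label :: "'s \<Rightarrow> 'o"

text \<open>
  \<open>transition_system Y G T\<close> says that \<open>T\<close> is a finite \<open>G\<close>-labeled \<open>Y\<close>-transition system.
  The functions are total on the underlying types, but constrained only on the carriers.
\<close>

definition transition_system :: "'i set \<Rightarrow> 'o set \<Rightarrow> ('s, 'i, 'o) ts \<Rightarrow> bool" where
  "transition_system Y G T \<longleftrightarrow>
     finite (ts_states T) \<and> ts_init T \<in> ts_states T \<and>
     (\<forall>s \<in> ts_states T. \<forall>y \<in> Y. ts_trans T s y \<in> ts_states T) \<and>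
     (\<forall>s \<in> ts_states T. ts_label T s \<in> G)"

definition ts_reach :: "('s, 'i, 'o) ts \<Rightarrow> 'i list \<Rightarrow> 's" where
  "ts_reach T xs = foldl (ts_trans T) (ts_init T) xs"

definition trace :: "('s, 'p set, 'p set) ts \<Rightarrow> 'p set word \<Rightarrow> 'p set word" where
  "trace T u = (\<lambda>i. u i \<union> ts_label T (ts_reach T (prefix i u)))"

definition traces :: "'p set set \<Rightarrow> ('s, 'p set, 'p set) ts \<Rightarrow> 'p set word set" where
  "traces Y T = {trace T u | u. \<forall>i. u i \<in> Y}"

text \<open>Tuples are lists: \<open>tuples k A\<close> is the \<open>k\<close>-fold Cartesian power of \<open>A\<close>.\<close>

definition tuples :: "nat \<Rightarrow> 'a set \<Rightarrow> 'a list set" where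
  "tuples k A = {xs. length xs = k \<and> set xs \<subseteq> A}"

definition ts_trans_tuple :: "('s, 'i, 'o) ts \<Rightarrow> 's list \<Rightarrow> 'i list \<Rightarrow> 's list" where
  "ts_trans_tuple T ss ys = map2 (ts_trans T) ss ys"

definition ts_label_tuple :: "('s, 'i, 'o) ts \<Rightarrow> 's list \<Rightarrow> 'o list" where
  "ts_label_tuple T ss = map (ts_label T) ss"

text \<open>The Boolean and temporal operators not listed are derived from these as usual.\<close>

datatype (qf_props: 'p, qf_vars: 'v) qf =
    TT
  | Atom 'p 'v
  | Neg "('p, 'v) qf"
  | Disj "('p, 'v) qf" "('p, 'v) qf"
  | Next "('p, 'v) qf"
  | Until "('p, 'v) qf" "('p, 'v) qf"

datatype ('p, 'v) hyperltl =
    Forall 'v "('p, 'v) hyperltl"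
  | Exists 'v "('p, 'v) hyperltl"
  | Body "('p, 'v) qf"

type_synonym ('p, 'v) assignment = "'v \<rightharpoonup> 'p set word"

primrec qf_sat :: "('p, 'v) assignment \<Rightarrow> nat \<Rightarrow> ('p, 'v) qf \<Rightarrow> bool" where
  "qf_sat P i TT \<longleftrightarrow> True"
| "qf_sat P i (Atom a v) \<longleftrightarrow> (\<exists>t. P v = Some t \<and> a \<in> t i)"
| "qf_sat P i (Neg f) \<longleftrightarrow> \<not> qf_sat P i f"
| "qf_sat P i (Disj f g) \<longleftrightarrow> qf_sat P i f \<or> qf_sat P i g"
| "qf_sat P i (Next f) \<longleftrightarrow> qf_sat P (Suc i) f"
| "qf_sat P i (Until f g) \<longleftrightarrow>
     (\<exists>j \<ge> i. qf_sat P j g \<and> (\<forall>k. i \<le> k \<and> k < j \<longrightarrow> qf_sat P k f))"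

primrec hyperltl_sat ::
  "'p set word set \<Rightarrow> ('p, 'v) assignment \<Rightarrow> ('p, 'v) hyperltl \<Rightarrow> bool" where
  "hyperltl_sat Tr P (Forall v h) \<longleftrightarrow> (\<forall>t \<in> Tr. hyperltl_sat Tr (P(v \<mapsto> t)) h)"
| "hyperltl_sat Tr P (Exists v h) \<longleftrightarrow> (\<exists>t \<in> Tr. hyperltl_sat Tr (P(v \<mapsto> t)) h)"
| "hyperltl_sat Tr P (Body f) \<longleftrightarrow> qf_sat P 0 f"

definition models ::
  "'p set set \<Rightarrow> ('s, 'p set, 'p set) ts \<Rightarrow> ('p, 'v) hyperltl \<Rightarrow> bool" where
  "models Y T h \<longleftrightarrow> hyperltl_sat (traces Y T) Map.empty h"

definition forall_exists :: "'v list \<Rightarrow> 'v list \<Rightarrow> ('p, 'v) qf \<Rightarrow> ('p, 'v) hyperltl" where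
  "forall_exists vs ws f = foldr Forall vs (foldr Exists ws (Body f))"

record ('q, 'i, 'o) ucb =
  ucb_states :: "'q set"
  ucb_init :: 'q
  ucb_delta :: "'q \<Rightarrow> 'i list \<Rightarrow> 'o list \<Rightarrow> 'q set"
  ucb_rej :: "'q set"

definition co_buchi_automaton ::
  "nat \<Rightarrow> 'i set \<Rightarrow> 'o set \<Rightarrow> ('q, 'i, 'o) ucb \<Rightarrow> bool" where
  "co_buchi_automaton k Y G A \<longleftrightarrow>
     finite (ucb_states A) \<and> ucb_init A \<in> ucb_states A \<and> ucb_rej A \<subseteq> ucb_states A \<and>
     (\<forall>q \<in> ucb_states A. \<forall>ys \<in> tuples k Y. \<forall>gs \<in> tuples k G.
        ucb_delta A q ys gs \<subseteq> ucb_states A)"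

definition ucb_accepts :: "('q, 'i, 'o) ucb \<Rightarrow> ('i list \<times> 'o list) word \<Rightarrow> bool" where
  "ucb_accepts A w \<longleftrightarrow>
     (\<forall>r. r 0 = ucb_init A \<and>
          (\<forall>i. r (Suc i) \<in> ucb_delta A (r i) (fst (w i)) (snd (w i)))
        \<longrightarrow> finite {i. r i \<in> ucb_rej A})"

definition word_assignment ::
  "'v list \<Rightarrow> ('p set list \<times> 'p set list) word \<Rightarrow> ('p, 'v) assignment" where
  "word_assignment vs w =
     [vs [\<mapsto>] map (\<lambda>j i. fst (w i) ! j \<union> snd (w i) ! j) [0..<length vs]]"

text \<open>
  \<open>ucb_for Y G vs f A\<close>: the automaton \<open>A\<close> is a universal co-Buechi automaton for \<open>f\<close>, where
  the \<open>j\<close>-th components of the letters describe the trace assigned to \<open>vs ! j\<close>.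
\<close>

definition ucb_for ::
  "'p set set \<Rightarrow> 'p set set \<Rightarrow> 'v list \<Rightarrow> ('p, 'v) qf \<Rightarrow> ('q, 'p set, 'p set) ucb \<Rightarrow> bool" where
  "ucb_for Y G vs f A \<longleftrightarrow>
     co_buchi_automaton (length vs) Y G A \<and>
     (\<forall>w. (\<forall>i. w i \<in> tuples (length vs) Y \<times> tuples (length vs) G) \<longrightarrow>
        (ucb_accepts A w \<longleftrightarrow> qf_sat (word_assignment vs w) 0 f))"

type_synonym ('s, 'x, 'q) vertex = "'s list \<times> 's list \<times> 'x \<times> 'q"

definition rg_vertices ::
  "nat \<Rightarrow> nat \<Rightarrow> ('s, 'i, 'o) ts \<Rightarrow> ('x, 'i list, 'i list) ts \<Rightarrow> ('q, 'i, 'o) ucb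
     \<Rightarrow> ('s, 'x, 'q) vertex set" where
  "rg_vertices n m T E A =
     tuples n (ts_states T) \<times> tuples m (ts_states T) \<times> ts_states E \<times> ucb_states A"

definition rg_init ::
  "nat \<Rightarrow> nat \<Rightarrow> ('s, 'i, 'o) ts \<Rightarrow> ('x, 'i list, 'i list) ts \<Rightarrow> ('q, 'i, 'o) ucb
     \<Rightarrow> ('s, 'x, 'q) vertex" where
  "rg_init n m T E A =
     (replicate n (ts_init T), replicate m (ts_init T), ts_init E, ucb_init A)"

definition rg_edges ::
  "'i set \<Rightarrow> nat \<Rightarrow> nat \<Rightarrow> ('s, 'i, 'o) ts \<Rightarrow> ('x, 'i list, 'i list) ts \<Rightarrow> ('q, 'i, 'o) ucb
     \<Rightarrow> ('s, 'x, 'q) vertex rel" where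
  "rg_edges Y n m T E A =
     {((sn, sm, x, q), (sn', sm', x', q')).
        (sn, sm, x, q) \<in> rg_vertices n m T E A \<and>
        (sn', sm', x', q') \<in> rg_vertices n m T E A \<and>
        (\<exists>ys \<in> tuples n Y.
           sn' = ts_trans_tuple T sn ys \<and>
           sm' = ts_trans_tuple T sm (ts_label E x) \<and>
           x' = ts_trans E x ys \<and>
           q' \<in> ucb_delta A q (ys @ ts_label E x) (ts_label_tuple T sn @ ts_label_tuple T sm))}"

definition rg_accepting ::
  "'i set \<Rightarrow> nat \<Rightarrow> nat \<Rightarrow> ('s, 'i, 'o) ts \<Rightarrow> ('x, 'i list, 'i list) ts \<Rightarrow> ('q, 'i, 'o) ucb
     \<Rightarrow> bool" where
  "rg_accepting Y n m T E A \<longleftrightarrow>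
     (\<forall>p. p 0 = rg_init n m T E A \<and> (\<forall>i. (p i, p (Suc i)) \<in> rg_edges Y n m T E A)
        \<longrightarrow> finite {i. \<exists>sn sm x q. p i = (sn, sm, x, q) \<and> q \<in> ucb_rej A})"

end

theory Submission
  imports Defs
begin

text \<open>
  Input words \<open>us\<close> of the universally quantified traces drive \<open>E\<close>, whose labels are read
  componentwise as input words of the witness traces; as \<open>E\<close> emits its label before it reads
  the current input, these words are well defined. A run of the automaton on the combined word is
  then the last component of a path of the run graph, so the automaton accepts that word.
\<close>

lemma tuples_0: "tuples 0 X = {[]}"
  by (auto simp: tuples_def)

lemma tuples_Suc: "tuples (Suc k) X = (\<Union>x \<in> X. (#) x ` tuples k X)"
  by (auto simp: tuples_def length_Suc_conv image_iff)

text \<open>Induction peels off the outermost quantifier; \<open>P\<close> is generalised because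
  that quantifier updates it. The update \<open>[\<mapsto>]\<close> also works from left to right,
  so inner bindings override outer ones on both sides.\<close>

lemma hyperltl_sat_foldr_Forall:
  "hyperltl_sat Tr P (foldr Forall vs h) \<longleftrightarrow>
     (\<forall>ts \<in> tuples (length vs) Tr. hyperltl_sat Tr (P(vs [\<mapsto>] ts)) h)"
  by (induction vs arbitrary: P) (simp_all add: tuples_0 tuples_Suc)

lemma hyperltl_sat_foldr_Exists:
  "hyperltl_sat Tr P (foldr Exists vs h) \<longleftrightarrow>
     (\<exists>ts \<in> tuples (length vs) Tr. hyperltl_sat Tr (P(vs [\<mapsto>] ts)) h)"
  by (induction vs arbitrary: P) (simp_all add: tuples_0 tuples_Suc)

text \<open>Updates pair names with values by \<open>zip\<close>; equal lengths keep the second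
  blocks aligned.\<close>

lemma map_upds_append:
  assumes "length xs = length ys"
  shows "m(xs @ xs' [\<mapsto>] ys @ ys') = (m(xs [\<mapsto>] ys))(xs' [\<mapsto>] ys')"
  using assms by (simp add: map_upds_def)

text \<open>Merges both quantifier blocks into one assignment on \<open>vs @ ws\<close>, the shape
  in which \<open>ucb_for\<close> speaks about the formula.\<close>

lemma models_forall_existsI:
  assumes "\<And>ts. ts \<in> tuples (length vs) (traces Y T) \<Longrightarrow>
      \<exists>ss \<in> tuples (length ws) (traces Y T). qf_sat [vs @ ws [\<mapsto>] ts @ ss] 0 f"
  shows "models Y T (forall_exists vs ws f)"
  unfolding models_def forall_exists_def hyperltl_sat_foldr_Forall hyperltl_sat_foldr_Exists
proof
  fix ts
  assume ts: "ts \<in> tuples (length vs) (traces Y T)"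
  then obtain ss where "ss \<in> tuples (length ws) (traces Y T)"
      "qf_sat [vs @ ws [\<mapsto>] ts @ ss] 0 f"
    using assms by blast
  moreover have "length vs = length ts"
    using ts by (simp add: tuples_def)
  ultimately show "\<exists>ss \<in> tuples (length ws) (traces Y T).
      hyperltl_sat (traces Y T) ([vs [\<mapsto>] ts](ws [\<mapsto>] ss)) (Body f)"
    by (auto simp: map_upds_append)
qed

lemma tuples_image: "tuples k (h ` X) = map h ` tuples k X"
proof -
  have tuples_lists: "tuples k Z = {xs \<in> lists Z. length xs = k}" for Z :: "'z set"
    by (auto simp: tuples_def)
  show ?thesis
    unfolding tuples_lists lists_image by auto
qed

text \<open>Read one way, this exposes the input words behind the universal traces; read the other
  way, it certifies the witnesses as traces.\<close>

lemma tuples_traces_conv: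
  "tuples k (traces Y T) = map (trace T) ` tuples k {u. \<forall>i. u i \<in> Y}"
proof -
  have "traces Y T = trace T ` {u. \<forall>i. u i \<in> Y}"
    by (auto simp: traces_def)
  then show ?thesis
    by (simp add: tuples_image)
qed

lemma ts_reach_Nil [simp]: "ts_reach T [] = ts_init T"
  by (simp add: ts_reach_def)

lemma ts_reach_snoc [simp]: "ts_reach T (xs @ [x]) = ts_trans T (ts_reach T xs) x"
  by (simp add: ts_reach_def)

lemma ts_reach_in_states:
  assumes "transition_system Y G T" and "\<forall>i. u i \<in> Y"
  shows "ts_reach T (prefix i u) \<in> ts_states T"
  using assms by (induction i) (auto simp: transition_system_def)

text \<open>The word that the automaton reads when one copy of \<open>T\<close> runs on each word of
  \<open>us\<close>. The output at \<open>i\<close> depends only on inputs before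
  \<open>i\<close>.\<close>

definition letters :: "('s, 'i, 'o) ts \<Rightarrow> 'i word list \<Rightarrow> ('i list \<times> 'o list) word" where
  "letters T us = (\<lambda>i. (map (\<lambda>u. u i) us, map (\<lambda>u. ts_label T (ts_reach T (prefix i u))) us))"

text \<open>Uniting the two entries at index \<open>j\<close> yields the trace of the
  \<open>j\<close>-th copy, so acceptance of \<open>letters\<close> becomes a statement about traces
  of \<open>T\<close>.\<close>

lemma word_assignment_letters:
  assumes "length us = length vs"
  shows "word_assignment vs (letters T us) = [vs [\<mapsto>] map (trace T) us]"
proof -
  have "map (\<lambda>j i. fst (letters T us i) ! j \<union> snd (letters T us i) ! j) [0..<length vs]
      = map (trace T) us"
    using assms by (intro nth_equalityI) (auto simp: letters_def trace_def)
  then show ?thesis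
    by (simp add: word_assignment_def)
qed

lemma map_letter_in_tuples:
  assumes "us \<in> tuples k {u. \<forall>i. u i \<in> Y}"
  shows "map (\<lambda>u. u i) us \<in> tuples k Y"
  using assms unfolding tuples_def by fastforce

lemma letters_in_tuples:
  assumes "transition_system Y G T" and "us \<in> tuples k {u. \<forall>i. u i \<in> Y}"
  shows "letters T us i \<in> tuples k Y \<times> tuples k G"
proof -
  have "ts_label T (ts_reach T (prefix i u)) \<in> G" if "u \<in> set us" for u
    using assms that ts_reach_in_states[OF assms(1), of u i]
    by (auto simp: tuples_def transition_system_def)
  then show ?thesis
    using assms(2) map_letter_in_tuples[OF assms(2)] by (auto simp: letters_def tuples_def)
qed

text \<open>Transposes a word of tuples into a tuple of words, which splits the label sequence of
  \<open>E\<close> into separate input words.\<close>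

definition components :: "nat \<Rightarrow> 'a list word \<Rightarrow> 'a word list" where
  "components k w = map (\<lambda>j i. w i ! j) [0..<k]"

lemma map_components:
  assumes "w i \<in> tuples k Y"
  shows "map (\<lambda>u. u i) (components k w) = w i"
  using assms by (intro nth_equalityI) (auto simp: components_def tuples_def)

lemma components_in_tuples:
  assumes "\<And>i. w i \<in> tuples k Y"
  shows "components k w \<in> tuples k {u. \<forall>i. u i \<in> Y}"
proof -
  have "w i ! j \<in> Y" if "j < k" for i j
    using assms[of i] that by (auto simp: tuples_def)
  then show ?thesis
    by (auto simp: components_def tuples_def)
qed

text \<open>All vertex components but the last are determined by \<open>us\<close>, since
  \<open>label\<close> makes \<open>us'\<close> the inputs that \<open>E\<close> feeds to the
  witness copies. Hence every run of \<open>A\<close> extends to a path with the same rejecting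
  visits.\<close>

lemma rg_accepting_imp_ucb_accepts:
  assumes T: "transition_system Y G T"
    and E: "transition_system (tuples n Y) (tuples m Y) E"
    and A: "co_buchi_automaton (n + m) Y G A"
    and acc: "rg_accepting Y n m T E A"
    and us: "us \<in> tuples n {u. \<forall>i. u i \<in> Y}"
    and us': "us' \<in> tuples m {u. \<forall>i. u i \<in> Y}"
    and label: "\<And>i. ts_label E (ts_reach E (prefix i (\<lambda>j. map (\<lambda>u. u j) us)))
                   = map (\<lambda>u. u i) us'"
  shows "ucb_accepts A (letters T (us @ us'))"
  unfolding ucb_accepts_def
proof (intro allI impI)
  fix r
  let ?w = "letters T (us @ us')"
  assume "r 0 = ucb_init A \<and> (\<forall>i. r (Suc i) \<in> ucb_delta A (r i) (fst (?w i)) (snd (?w i)))"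
  then have r0: "r 0 = ucb_init A"
    and rS: "\<And>i. r (Suc i) \<in> ucb_delta A (r i) (fst (?w i)) (snd (?w i))"
    by auto
  have "us @ us' \<in> tuples (n + m) {u. \<forall>i. u i \<in> Y}"
    using us us' by (auto simp: tuples_def)
  then have w: "?w i \<in> tuples (n + m) Y \<times> tuples (n + m) G" for i
    using letters_in_tuples[OF T] by blast
  \<comment> \<open>Edges join only vertices in the carriers, whereas \<open>ucb_accepts\<close>
    ranges over arbitrary \<open>r\<close>; that runs stay in the carrier has to be derived.\<close>
  have r: "r i \<in> ucb_states A" for i
  proof (induction i)
    case 0
    then show ?case
      using A r0 by (simp add: co_buchi_automaton_def)
  next
    case (Suc i)
    then have "ucb_delta A (r i) (fst (?w i)) (snd (?w i)) \<subseteq> ucb_states A"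
      using A w[of i] by (simp add: co_buchi_automaton_def mem_Times_iff)
    then show ?case
      using rS by blast
  qed
  define ys where "ys i = map (\<lambda>u. u i) us" for i
  define sts where "sts i = map (\<lambda>u. ts_reach T (prefix i u))" for i
  define p where
    "p i = (sts i us, sts i us', ts_reach E (prefix i ys), r i)" for i
  have ys: "ys i \<in> tuples n Y" for i
    unfolding ys_def by (rule map_letter_in_tuples[OF us])
  have sts: "sts i us0 \<in> tuples k (ts_states T)"
    if "us0 \<in> tuples k {u. \<forall>i. u i \<in> Y}" for i k us0
    using that ts_reach_in_states[OF T] by (auto simp: sts_def tuples_def)
  have trans: "sts (Suc i) us0 = ts_trans_tuple T (sts i us0) (map (\<lambda>u. u i) us0)" for i us0
    by (induction us0) (simp_all add: sts_def ts_trans_tuple_def)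
  have reach: "ts_reach E (prefix i ys) \<in> ts_states E" for i
    using ts_reach_in_states[OF E] ys by blast
  have label': "ts_label E (ts_reach E (prefix i ys)) = map (\<lambda>u. u i) us'" for i
    using label by (simp add: ys_def[abs_def])
  have p: "p i \<in> rg_vertices n m T E A" for i
    using sts us us' reach r by (simp add: p_def rg_vertices_def)
  have "p 0 = rg_init n m T E A"
    using us us' by (simp add: p_def sts_def rg_init_def r0 tuples_def map_replicate_const)
  moreover have "(p i, p (Suc i)) \<in> rg_edges Y n m T E A" for i
  proof -
    \<comment> \<open>The letter splits after its first \<open>n\<close> entries: \<open>us\<close>
      gives the universal part, and \<open>label'\<close> identifies the remaining inputs with the
      label of \<open>E\<close>.\<close>
    have "r (Suc i) \<in> ucb_delta A (r i) (ys i @ map (\<lambda>u. u i) us')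
        (ts_label_tuple T (sts i us) @ ts_label_tuple T (sts i us'))"
      using rS[of i] by (simp add: letters_def ts_label_tuple_def sts_def ys_def comp_def)
    then show ?thesis
      using p[of i] p[of "Suc i"] ys[of i] trans[of i us] trans[of i us']
      unfolding rg_edges_def p_def
      by (auto simp: label' ys_def[of i, symmetric] intro!: bexI[of _ "ys i"])
  qed
  ultimately have "finite {i. \<exists>sn sm x q. p i = (sn, sm, x, q) \<and> q \<in> ucb_rej A}"
    using acc by (simp add: rg_accepting_def)
  then show "finite {i. r i \<in> ucb_rej A}"
    by (simp add: p_def)
qed

theorem theorem7:
  fixes Inp Outp :: "'p set"
    and T :: "('s, 'p set, 'p set) ts"
    and E :: "('x, 'p set list, 'p set list) ts"
    and A :: "('q, 'p set, 'p set) ucb"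
    and vs ws :: "'v list"
    and f :: "('p, 'v) qf"
    and n m :: nat
  assumes "finite Inp" and "finite Outp" and "Inp \<inter> Outp = {}"
    and "transition_system (Pow Inp) (Pow Outp) T"
    and "length vs = n" and "length ws = m" and "distinct (vs @ ws)"
    and "qf_props f \<subseteq> Inp \<union> Outp" and "qf_vars f \<subseteq> set (vs @ ws)"
    and "transition_system (tuples n (Pow Inp)) (tuples m (Pow Inp)) E"
    and "ucb_for (Pow Inp) (Pow Outp) (vs @ ws) f A"
    and "rg_accepting (Pow Inp) n m T E A"
  shows "models (Pow Inp) T (forall_exists vs ws f)"
proof (rule models_forall_existsI)
  let ?Y = "Pow Inp" and ?G = "Pow Outp"
  note T = assms(4) and E = assms(10)
  have len: "length (vs @ ws) = n + m"
    using assms(5,6) by simp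
  fix ts
  assume "ts \<in> tuples (length vs) (traces ?Y T)"
  then obtain us where us: "us \<in> tuples n {u. \<forall>i. u i \<in> ?Y}" and ts: "ts = map (trace T) us"
    using assms(5) by (auto simp: tuples_traces_conv)
  define ys where "ys i = map (\<lambda>u. u i) us" for i
  \<comment> \<open>\<open>prefix i ys\<close> excludes \<open>ys i\<close>, so \<open>zs 0\<close>
    is the label of the initial state of \<open>E\<close>.\<close>
  define zs where "zs i = ts_label E (ts_reach E (prefix i ys))" for i
  define us' where "us' = components m zs"
  have "\<forall>i. ys i \<in> tuples n ?Y"
    unfolding ys_def using map_letter_in_tuples[OF us] by blast
  then have zs: "zs i \<in> tuples m ?Y" for i
    using E ts_reach_in_states[OF E] by (simp add: zs_def transition_system_def)
  then have us': "us' \<in> tuples m {u. \<forall>i. u i \<in> ?Y}"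
    unfolding us'_def by (rule components_in_tuples)
  have "ucb_accepts A (letters T (us @ us'))"
  proof (rule rg_accepting_imp_ucb_accepts[OF T E _ assms(12) us us'])
    show "co_buchi_automaton (n + m) ?Y ?G A"
      using assms(11) len by (simp add: ucb_for_def)
    \<comment> \<open>Collecting the \<open>i\<close>-th letters of the components restores
      \<open>zs i\<close>, since \<open>zs i\<close> has length \<open>m\<close>.\<close>
    show "ts_label E (ts_reach E (prefix i (\<lambda>j. map (\<lambda>u. u j) us))) = map (\<lambda>u. u i) us'" for i
      using map_components[of zs i, OF zs] by (simp add: us'_def zs_def[of i] ys_def[abs_def])
  qed
  moreover have uss: "us @ us' \<in> tuples (length (vs @ ws)) {u. \<forall>i. u i \<in> ?Y}"
    using us us' len by (auto simp: tuples_def)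
  moreover have "word_assignment (vs @ ws) (letters T (us @ us'))
      = [vs @ ws [\<mapsto>] ts @ map (trace T) us']"
    using uss by (subst word_assignment_letters) (simp_all add: tuples_def ts)
  \<comment> \<open>\<open>ucb_for\<close> equates acceptance with satisfaction only for words over
    the alphabet, hence the appeal to \<open>letters_in_tuples\<close>.\<close>
  ultimately have "qf_sat [vs @ ws [\<mapsto>] ts @ map (trace T) us'] 0 f"
    using assms(11) letters_in_tuples[OF T uss] unfolding ucb_for_def by metis
  moreover have "map (trace T) us' \<in> tuples (length ws) (traces ?Y T)"
    using us' assms(6) by (simp add: tuples_traces_conv)
  ultimately show "\<exists>ss \<in> tuples (length ws) (traces ?Y T). qf_sat [vs @ ws [\<mapsto>] ts @ ss] 0 f"
    by blast
qed

end
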